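(* Let $a,b$ be integers with $2\le a<b$, and let $H=\mathrm{S}\left(\left]\frac{b}{a},\frac{b}{a-1}\right[\right)$ be the numerical semigroup associated to the open interval $\left]\frac{b}{a},\frac{b}{a-1}\right[$. Then the multiplicity of $H$ is $$\mathrm{m}(H)=\left\lfloor\frac{\delta b}{a}\right\rfloor+1,$$ where $$\delta=\min\left\{k\in\{1,2,\dots,a-1\}\ \middle|\ (kb \bmod a)+\left\lfloor\frac{kb}{a}\right\rfloor>a-1\right\}.$$
   Context: A numerical semigroup is a subset $H\subseteq\mathbb{N}=\{0,1,2,\dots\}$ containing $0$, closed under addition, with $\mathbb{N}\setminus H$ finite; its multiplicity $\mathrm{m}(H)$ is its least nonzero element. For an interval $I$ of positive real numbers, $\langle I\rangle$ denotes the submonoid of $(\mathbb{R}_{\ge 0},+)$ generated by $I$, and $\mathrm{S}(I)=\langle I\rangle\cap\mathbb{N}$. $]p,q[$ denotes the open interval from $p$ to $q$. For integers $u$ and $a>0$, $u\bmod a$ is the remainder in $\{0,\dots,a-1\}$ of the division of $u$ by $a$, and $\lfloor r\rfloor$ is the largest integer not bigger than $r$. *)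

theory Defs
  imports Complex_Main
begin

definition numerical_semigroup :: "nat set \<Rightarrow> bool" where
  "numerical_semigroup H \<longleftrightarrow>
     0 \<in> H \<and> (\<forall>x\<in>H. \<forall>y\<in>H. x + y \<in> H) \<and> finite (UNIV - H)"

definition semigroup_multiplicity :: "nat set \<Rightarrow> nat" where
  "semigroup_multiplicity H = (LEAST n. n \<in> H \<and> n \<noteq> 0)"

definition nonneg_submonoid :: "real set \<Rightarrow> bool" where
  "nonneg_submonoid M \<longleftrightarrow> M \<subseteq> {0..} \<and> 0 \<in> M \<and> (\<forall>x\<in>M. \<forall>y\<in>M. x + y \<in> M)"

text \<open>Only meaningful for \<open>I \<subseteq> {0..}\<close>: otherwise no such submonoid contains \<open>I\<close>, and the
  hull is \<open>UNIV\<close>.\<close>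

definition generated_monoid :: "real set \<Rightarrow> real set" where
  "generated_monoid I = nonneg_submonoid hull I"

definition interval_semigroup :: "real set \<Rightarrow> nat set" where
  "interval_semigroup I = {n. real n \<in> generated_monoid I}"

lemma generated_monoid_base: "x \<in> I \<Longrightarrow> x \<in> generated_monoid I"
  unfolding generated_monoid_def by (rule hull_inc)

lemma generated_monoid_zero: "0 \<in> generated_monoid I"
  unfolding generated_monoid_def hull_def nonneg_submonoid_def by blast

lemma generated_monoid_add:
  "x \<in> generated_monoid I \<Longrightarrow> y \<in> generated_monoid I \<Longrightarrow> x + y \<in> generated_monoid I"
  unfolding generated_monoid_def hull_def nonneg_submonoid_def by blast

lemma generated_monoid_mult:
  "x \<in> generated_monoid I \<Longrightarrow> real k * x \<in> generated_monoid I"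
  by (induction k) (auto simp: generated_monoid_zero generated_monoid_add distrib_right)

lemma numerical_semigroup_interval_semigroup:
  fixes p q :: real
  assumes "0 < p" "p < q"
  shows "numerical_semigroup (interval_semigroup {p<..<q})"
proof -
  let ?N = "nat \<lceil>p * q / (q - p)\<rceil>"
  have mem: "n \<in> interval_semigroup {p<..<q}" if "?N < n" for n
  proof -
    have "p * q / (q - p) < real n" using that by linarith
    then have "p * q < real n * (q - p)" using assms by (simp add: field_simps)
    then have gap: "real n / q + 1 < real n / p" using assms by (simp add: field_simps)
    define k where "k = nat (\<lfloor>real n / q\<rfloor> + 1)"
    have "0 \<le> real n / q" using assms by simp
    then have k: "real n / q < real k" "real k \<le> real n / q + 1"
      unfolding k_def by linarith+
    then have k0: "0 < real k" using \<open>0 \<le> real n / q\<close> by linarith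
    have "real n < q * real k" using k(1) assms by (simp add: field_simps)
    moreover have "real k < real n / p" using k(2) gap by linarith
    then have "p * real k < real n" using assms by (simp add: field_simps)
    ultimately have "real n / real k \<in> {p<..<q}" using k0 by (simp add: field_simps)
    then have "real k * (real n / real k) \<in> generated_monoid {p<..<q}"
      by (intro generated_monoid_mult generated_monoid_base)
    then show ?thesis using k0 by (simp add: interval_semigroup_def)
  qed
  then have "UNIV - interval_semigroup {p<..<q} \<subseteq> {..?N}"
    using leI by blast
  then have "finite (UNIV - interval_semigroup {p<..<q})"
    using finite_subset by blast
  then show ?thesis
    by (auto simp: numerical_semigroup_def interval_semigroup_def
        generated_monoid_zero generated_monoid_add)
qed

end

theory Submission
  imports Defs
begin

text \<open>A positive integer \<open>n\<close> lies in \<open>H\<close> iff \<open>n (a - 1) < k b < n a\<close> for some \<open>k \<ge> 1\<close>. For fixed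
  \<open>k\<close> the least \<open>n\<close> with \<open>k b < n a\<close> is \<open>\<lfloor>k b / a\<rfloor> + 1\<close>, and it satisfies the other inequality iff
  \<open>(k b mod a) + \<lfloor>k b / a\<rfloor> > a - 1\<close>. Since \<open>\<lfloor>k b / a\<rfloor>\<close> is monotone in \<open>k\<close>, the least admissible \<open>k\<close>
  gives the multiplicity; \<open>k = a - 1\<close> is always admissible because \<open>a < b\<close>.\<close>

text \<open>A sum of \<open>k\<close> elements of the interval lies strictly between
  \<open>k * p\<close> and \<open>k * q\<close>; conversely, such an \<open>x\<close> is
  \<open>k\<close> copies of \<open>x / k\<close>. The forward direction is minimality of the hull,
  since these sums form a submonoid.\<close>

lemma mem_generated_monoid_open_interval:
  fixes p q :: real
  assumes "0 \<le> p"
  shows "x \<in> generated_monoid {p<..<q} \<longleftrightarrow>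
    x = 0 \<or> (\<exists>k>0. real k * p < x \<and> x < real k * q)" (is "_ \<longleftrightarrow> ?R x")
proof
  assume x: "x \<in> generated_monoid {p<..<q}"
  have "nonneg_submonoid (Collect ?R)"
    unfolding nonneg_submonoid_def
  proof (intro conjI ballI subsetI)
    fix y assume "y \<in> Collect ?R"
    then consider "y = 0" | k where "real k * p < y" by blast
    then show "y \<in> {0..}"
    proof cases
      case 2
      moreover have "0 \<le> real k * p" using assms by simp
      ultimately show ?thesis by simp
    qed simp
  next
    fix y z assume y: "y \<in> Collect ?R" and z: "z \<in> Collect ?R"
    show "y + z \<in> Collect ?R"
    \<comment> \<open>As \<open>0 \<le> p\<close>, zero satisfies the strict bounds for no
      \<open>k > 0\<close>, so it is split off. Otherwise the two counts add.\<close>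
    proof (cases "y = 0 \<or> z = 0")
      case False
      then obtain k l where
        "k > 0" "real k * p < y" "y < real k * q" "real l * p < z" "z < real l * q"
        using y z by auto
      then have "k + l > 0 \<and> real (k + l) * p < y + z \<and> y + z < real (k + l) * q"
        by (simp add: distrib_right)
      then show ?thesis by blast
    qed (use y z in auto)
  qed simp
  moreover have "{p<..<q} \<subseteq> Collect ?R"
    by (auto intro!: exI[of _ "1::nat"])
  ultimately have "generated_monoid {p<..<q} \<subseteq> Collect ?R"
    unfolding generated_monoid_def by (intro hull_minimal)
  then show "?R x" using x by blast
next
  assume "?R x"
  then show "x \<in> generated_monoid {p<..<q}"
  proof
    assume "\<exists>k>0. real k * p < x \<and> x < real k * q"
    then obtain k where k: "k > 0" "real k * p < x" "x < real k * q" by blast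
    then have "x / real k \<in> {p<..<q}" by (simp add: field_simps)
    then have "real k * (x / real k) \<in> generated_monoid {p<..<q}"
      by (intro generated_monoid_mult generated_monoid_base)
    then show ?thesis using k(1) by simp
  qed (simp add: generated_monoid_zero)
qed

text \<open>Clearing the positive denominators \<open>a\<close> and \<open>a - 1\<close> turns the
  real bounds into integer ones.\<close>

lemma mem_interval_semigroup_int:
  fixes a b :: int
  assumes "2 \<le> a" "0 < b" "n \<noteq> 0"
  shows "n \<in> interval_semigroup {real_of_int b / real_of_int a <..< real_of_int b / real_of_int (a - 1)}
    \<longleftrightarrow> (\<exists>k>0. k * b < int n * a \<and> int n * (a - 1) < k * b)"
proof -
  have lower: "real k * (real_of_int b / real_of_int a) < real n \<longleftrightarrow> int k * b < int n * a" for k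
  proof -
    have "real k * (real_of_int b / real_of_int a) < real n \<longleftrightarrow>
        real_of_int (int k * b) < real_of_int (int n * a)"
      using assms by (simp add: field_simps)
    then show ?thesis by (simp only: of_int_less_iff)
  qed
  have upper: "real n < real k * (real_of_int b / real_of_int (a - 1)) \<longleftrightarrow>
      int n * (a - 1) < int k * b" for k
  proof -
    have "0 < real_of_int (a - 1)" using assms by simp
    then have "real n < real k * (real_of_int b / real_of_int (a - 1)) \<longleftrightarrow>
        real_of_int (int n * (a - 1)) < real_of_int (int k * b)"
      by (simp add: pos_less_divide_eq del: of_int_diff)
    then show ?thesis by (simp only: of_int_less_iff)
  qed
  have "0 \<le> real_of_int b / real_of_int a" using assms by simp
  then have "n \<in> interval_semigroup {real_of_int b / real_of_int a <..< real_of_int b / real_of_int (a - 1)}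
    \<longleftrightarrow> (\<exists>k>0. int k * b < int n * a \<and> int n * (a - 1) < int k * b)"
    using assms(3)
    by (simp only: interval_semigroup_def mem_Collect_eq mem_generated_monoid_open_interval lower upper) simp
  \<comment> \<open>The count \<open>k\<close> passes from \<open>nat\<close> to \<open>int\<close>,
    where \<delta> lives.\<close>
  also have "\<dots> \<longleftrightarrow> (\<exists>k>0. k * b < int n * a \<and> int n * (a - 1) < k * b)"
    by (metis of_nat_0_less_iff zero_less_imp_eq_int)
  finally show ?thesis .
qed

lemma int_div_less_iff_less_mult:
  fixes a c d :: int
  assumes "0 < a"
  shows "c div a < d \<longleftrightarrow> c < d * a"
proof -
  have "c div a < d \<longleftrightarrow> real_of_int c / real_of_int a < real_of_int d"
    by (metis floor_divide_of_int_eq floor_less_iff)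
  also have "\<dots> \<longleftrightarrow> real_of_int c < real_of_int (d * a)"
    using assms by (simp add: pos_divide_less_eq)
  finally show ?thesis by (simp only: of_int_less_iff)
qed

text \<open>Substitute \<open>c = (c div a) * a + c mod a\<close>. For \<open>c = k * b\<close> the
  right side is the condition in the definition of \<delta>.\<close>

lemma Suc_div_mult_pred_less_iff:
  fixes a c :: int
  shows "(c div a + 1) * (a - 1) < c \<longleftrightarrow> a - 1 < c mod a + c div a"
proof -
  have "c = c div a * a + c mod a" by simp
  moreover have "(c div a + 1) * (a - 1) = c div a * a - c div a + a - 1"
    by (simp add: algebra_simps)
  ultimately show ?thesis by linarith
qed

text \<open>This makes the set defining \<delta> nonempty, so that its \<open>Min\<close> is a
  member. From \<open>a < b\<close> the quotient is below \<open>b - 1\<close>, hence its successor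
  is below \<open>b\<close>.\<close>

lemma pred_mult_admissible:
  fixes a b :: int
  assumes "2 \<le> a" "a < b"
  shows "a - 1 < ((a - 1) * b) mod a + ((a - 1) * b) div a"
proof -
  define q where "q = ((a - 1) * b) div a"
  have "(a - 1) * b < (b - 1) * a" using assms by (simp add: algebra_simps)
  then have "q < b - 1"
    using assms(1) unfolding q_def by (subst int_div_less_iff_less_mult) simp_all
  then have "(q + 1) * (a - 1) < b * (a - 1)"
    using assms by (intro mult_strict_right_mono) auto
  then have "(q + 1) * (a - 1) < (a - 1) * b" by (simp add: mult.commute)
  then show ?thesis unfolding q_def Suc_div_mult_pred_less_iff .
qed

theorem theorem4p11:
  fixes a b \<delta> :: int and H :: "nat set"
  assumes "2 \<le> a" and "a < b"
    and "H = interval_semigroup {real_of_int b / real_of_int a <..< real_of_int b / real_of_int (a - 1)}"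
    and "\<delta> = Min {k \<in> {1..a - 1}. (k * b) mod a + \<lfloor>real_of_int (k * b) / real_of_int a\<rfloor> > a - 1}"
  shows "int (semigroup_multiplicity H) = \<lfloor>real_of_int (\<delta> * b) / real_of_int a\<rfloor> + 1"
proof -
  define K where "K = {k \<in> {1..a - 1}. a - 1 < (k * b) mod a + (k * b) div a}"
  have \<delta>: "\<delta> = Min K"
    unfolding assms(4) K_def floor_divide_of_int_eq ..
  have "finite K" unfolding K_def by (rule finite_Collect_conjI) simp
  have "a - 1 \<in> K" using assms(1,2) pred_mult_admissible unfolding K_def by simp
  then have "\<delta> \<in> K" unfolding \<delta> using \<open>finite K\<close> Min_in by blast
  then have \<delta>_pos: "0 < \<delta>" and \<delta>_less: "\<delta> < a"
    and \<delta>_adm: "(\<delta> * b div a + 1) * (a - 1) < \<delta> * b"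
    unfolding K_def Suc_div_mult_pred_less_iff by auto
  have mem: "n \<in> H \<longleftrightarrow> (\<exists>k>0. k * b < int n * a \<and> int n * (a - 1) < k * b)" if "n \<noteq> 0" for n
    unfolding assms(3) using assms(1,2) that by (intro mem_interval_semigroup_int) auto
  \<comment> \<open>The least integer whose product with \<open>a\<close> exceeds
    \<open>\<delta> * b\<close>.\<close>
  define m where "m = nat (\<delta> * b div a + 1)"
  have "0 \<le> \<delta> * b div a"
    using assms(1,2) \<delta>_pos by (simp add: pos_imp_zdiv_nonneg_iff)
  then have m: "int m = \<delta> * b div a + 1" "m \<noteq> 0" unfolding m_def by auto
  have "semigroup_multiplicity H = m"
    unfolding semigroup_multiplicity_def
  proof (rule Least_equality)
    have "\<delta> * b < int m * a"
      unfolding m(1) using assms(1) by (simp flip: int_div_less_iff_less_mult)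
    moreover have "int m * (a - 1) < \<delta> * b" unfolding m(1) by (fact \<delta>_adm)
    ultimately show "m \<in> H \<and> m \<noteq> 0" using mem m(2) \<delta>_pos by blast
  next
    fix n assume "n \<in> H \<and> n \<noteq> 0"
    then obtain k where k: "0 < k" "k * b < int n * a" "int n * (a - 1) < k * b"
      using mem by blast
    have n: "k * b div a + 1 \<le> int n"
      using k(2) assms(1) by (simp flip: int_div_less_iff_less_mult)
    \<comment> \<open>The upper bound on \<open>n\<close> passes down to the smaller
      \<open>k * b div a + 1\<close>, which makes \<open>k\<close> admissible.\<close>
    then have "(k * b div a + 1) * (a - 1) \<le> int n * (a - 1)"
      using assms(1) by (intro mult_right_mono) auto
    then have "a - 1 < (k * b) mod a + (k * b) div a"
      using k(3) Suc_div_mult_pred_less_iff[of "k * b" a] by linarith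
    then have "k \<in> K" if "k < a" using that k(1) unfolding K_def by simp
    \<comment> \<open>Membership in \<open>H\<close> does not bound \<open>k\<close> by
      \<open>a - 1\<close>; if \<open>k \<ge> a\<close>, then \<delta> \<open>< a\<close>
      suffices.\<close>
    then have "\<delta> \<le> k" using \<delta>_less \<open>finite K\<close> unfolding \<delta> by (cases "k < a") auto
    then have "\<delta> * b div a \<le> k * b div a"
      using assms(1,2) by (intro zdiv_mono1 mult_right_mono) auto
    then show "m \<le> n" using n m(1) by linarith
  qed
  then show ?thesis using m(1) by (simp only: floor_divide_of_int_eq)
qed

end
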